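(* Every homogeneous ideal $I\subseteq\mathcal{A}_2=\mathbb{C}[x,y]$ has the stable division property with respect to the $H^2$ norm.
   Context: The $H^2$ norm on $\mathbb{C}[x,y]$ is the norm of the inner product for which distinct monomials are orthogonal and $\|x^ay^b\|^2=\frac{a!\,b!}{(a+b)!}$. A homogeneous ideal is an ideal generated by homogeneous polynomials. An ideal $I\subseteq\mathbb{C}[x,y]$ has the stable division property (with respect to a norm $\|\cdot\|$) if there are a finite set $\{f_1,\dots,f_k\}\subset I$ generating $I$ and a constant $C$ such that every $h\in I$ can be written $h=a_1f_1+\dots+a_kf_k$ with $a_i\in\mathbb{C}[x,y]$ and $\sum_i\|a_if_i\|^2\le C\|h\|^2$. *)

theory Defs
  imports Complex_Main "HOL-Computational_Algebra.Polynomial"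
begin

text \<open>
  The ring \<open>\<complex>[x,y]\<close> is rendered as \<open>\<complex>[x][y]\<close>, so the coefficient of \<open>x\<^sup>a y\<^sup>b\<close>
  in \<open>p\<close> is \<open>coeff (coeff p b) a\<close>.
\<close>

type_synonym cpoly2 = "complex poly poly"

definition coeff2 :: "cpoly2 \<Rightarrow> nat \<Rightarrow> nat \<Rightarrow> complex" where
  "coeff2 p a b = coeff (coeff p b) a"

definition monom2 :: "nat \<Rightarrow> nat \<Rightarrow> cpoly2" where
  "monom2 a b = monom (monom 1 a) b"

text \<open>
  Ideals of a commutative ring are the submodules of the ring viewed as a module over itself;
  the ideal generated by a set is its span.
\<close>

global_interpretation ideal: module "(*) :: 'a::comm_ring_1 \<Rightarrow> 'a \<Rightarrow> 'a"
  defines is_ideal = ideal.subspace and ideal_generated = ideal.span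
  by unfold_locales (simp_all add: algebra_simps)

text \<open>The zero polynomial counts as homogeneous (of every degree).\<close>

definition homogeneous :: "cpoly2 \<Rightarrow> bool" where
  "homogeneous p \<longleftrightarrow> (\<exists>n. \<forall>a b. coeff2 p a b \<noteq> 0 \<longrightarrow> a + b = n)"

definition homogeneous_ideal :: "cpoly2 set \<Rightarrow> bool" where
  "homogeneous_ideal I \<longleftrightarrow> (\<exists>S. (\<forall>f\<in>S. homogeneous f) \<and> I = ideal_generated S)"

text \<open>
  The exponents summed over contain the support of \<open>p\<close>; the lemmas below show that this is the
  hermitian form, linear in the first argument, for which distinct monomials are orthogonal and
  \<open>x\<^sup>a y\<^sup>b\<close> has squared norm \<open>a! b! / (a+b)!\<close>.
\<close>

definition H2_inner :: "cpoly2 \<Rightarrow> cpoly2 \<Rightarrow> complex" where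
  "H2_inner p q =
     (\<Sum>b\<le>degree p. \<Sum>a\<le>degree (coeff p b).
        of_real (fact a * fact b / fact (a + b)) * (coeff2 p a b * cnj (coeff2 q a b)))"

definition H2_norm :: "cpoly2 \<Rightarrow> real" where
  "H2_norm p = sqrt (Re (H2_inner p p))"

lemma H2_inner_monom2:
  "H2_inner (monom2 a b) (monom2 c d) =
     (if a = c \<and> b = d then of_real (fact a * fact b / fact (a + b)) else 0)"
proof -
  have "H2_inner (monom2 a b) (monom2 c d) =
     (\<Sum>j\<le>b. \<Sum>i\<le>degree (coeff (monom (monom (1::complex) a) b) j).
        if j = b \<and> i = a then
        of_real (fact a * fact b / fact (a + b)) * cnj (coeff2 (monom2 c d) a b) else 0)"
    unfolding H2_inner_def
    by (intro sum.cong) (auto simp: monom2_def coeff2_def degree_monom_eq)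
  also have "\<dots> = (\<Sum>j\<le>b. if j = b then
        of_real (fact a * fact b / fact (a + b)) * cnj (coeff2 (monom2 c d) a b) else 0)"
    by (intro sum.cong) (auto simp: degree_monom_eq)
  also have "\<dots> = of_real (fact a * fact b / fact (a + b)) * cnj (coeff2 (monom2 c d) a b)"
    by simp
  also have "\<dots> = (if a = c \<and> b = d then of_real (fact a * fact b / fact (a + b)) else 0)"
    by (auto simp: monom2_def coeff2_def)
  finally show ?thesis .
qed

lemma H2_inner_box:
  assumes "degree p \<le> n" and "\<And>b. degree (coeff p b) \<le> m"
  shows "H2_inner p q = (\<Sum>b\<le>n. \<Sum>a\<le>m.
           of_real (fact a * fact b / fact (a + b)) * (coeff2 p a b * cnj (coeff2 q a b)))"
proof -
  let ?t = "\<lambda>b a. complex_of_real (fact a * fact b / fact (a + b)) *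
                (coeff2 p a b * cnj (coeff2 q a b))"
  have "H2_inner p q = (\<Sum>b\<le>degree p. \<Sum>a\<le>m. ?t b a)"
    unfolding H2_inner_def
  proof (rule sum.cong[OF refl], rule sum.mono_neutral_left)
    show "{..degree (coeff p b)} \<subseteq> {..m}" for b
      using assms(2) by simp
  qed (auto simp: coeff2_def coeff_eq_0)
  also have "\<dots> = (\<Sum>b\<le>n. \<Sum>a\<le>m. ?t b a)"
    using assms(1) by (intro sum.mono_neutral_left) (auto simp: coeff2_def coeff_eq_0)
  finally show ?thesis .
qed

lemma ex_degree_bound: "\<exists>m. \<forall>b. degree (coeff (p :: cpoly2) b) \<le> m"
proof -
  have "degree (coeff p b) \<le> (\<Sum>j\<le>degree p. degree (coeff p j))" for b
  proof (cases "b \<le> degree p")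
    case True
    then show ?thesis
      by (intro member_le_sum) simp_all
  next
    case False
    then show ?thesis
      by (simp add: coeff_eq_0)
  qed
  then show ?thesis
    by blast
qed

lemma ex_common_box:
  obtains n m where "degree p \<le> n" "degree q \<le> n"
    "\<And>b. degree (coeff (p :: cpoly2) b) \<le> m" "\<And>b. degree (coeff (q :: cpoly2) b) \<le> m"
proof -
  obtain k where k: "\<forall>b. degree (coeff p b) \<le> k"
    using ex_degree_bound[of p] by blast
  obtain l where l: "\<forall>b. degree (coeff q b) \<le> l"
    using ex_degree_bound[of q] by blast
  show thesis
    by (rule that[of "max (degree p) (degree q)" "max k l"])
       (use k l in \<open>simp_all add: le_max_iff_disj\<close>)
qed

lemma H2_inner_add_left: "H2_inner (p + q) r = H2_inner p r + H2_inner q r"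
proof -
  obtain n m where nm: "degree p \<le> n" "degree q \<le> n"
      "\<And>b. degree (coeff p b) \<le> m" "\<And>b. degree (coeff q b) \<le> m"
    by (rule ex_common_box[of p q]) (rule that)
  have pq: "degree (p + q) \<le> n" "\<And>b. degree (coeff (p + q) b) \<le> m"
    unfolding coeff_add by (intro degree_add_le nm)+
  show ?thesis
    unfolding H2_inner_box[OF pq] H2_inner_box[OF nm(1,3)] H2_inner_box[OF nm(2,4)]
    by (simp only: coeff2_def coeff_add distrib_left distrib_right sum.distrib)
qed

lemma H2_inner_smult_left: "H2_inner (smult [:c:] p) q = c * H2_inner p q"
proof -
  obtain m where m: "\<And>b. degree (coeff p b) \<le> m"
    using ex_degree_bound[of p] by blast
  have cp: "degree (smult [:c:] p) \<le> degree p"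
    by (rule degree_smult_le)
  have cm: "degree (coeff (smult [:c:] p) b) \<le> m" for b
    using m[of b] by simp
  have c2: "coeff2 (smult [:c:] p) a b = c * coeff2 p a b" for a b
    by (simp add: coeff2_def)
  show ?thesis
    unfolding H2_inner_box[OF cp cm] H2_inner_box[OF order.refl m] sum_distrib_left
    unfolding c2 by (simp only: mult_ac)
qed

lemma H2_inner_commute: "H2_inner q p = cnj (H2_inner p q)"
proof -
  obtain n m where nm: "degree p \<le> n" "degree q \<le> n"
      "\<And>b. degree (coeff p b) \<le> m" "\<And>b. degree (coeff q b) \<le> m"
    by (rule ex_common_box[of p q]) (rule that)
  show ?thesis
    unfolding H2_inner_box[OF nm(1,3)] H2_inner_box[OF nm(2,4)] cnj_sum
    by (simp only: complex_cnj_mult complex_cnj_complex_of_real complex_cnj_cnj mult.commute)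
qed

definition stable_division :: "(cpoly2 \<Rightarrow> real) \<Rightarrow> cpoly2 set \<Rightarrow> bool" where
  "stable_division N I \<longleftrightarrow>
     (\<exists>F (C::real). finite F \<and> F \<subseteq> I \<and> ideal_generated F = I \<and>
        (\<forall>h\<in>I. \<exists>a. h = (\<Sum>f\<in>F. a f * f) \<and> (\<Sum>f\<in>F. (N (a f * f))\<^sup>2) \<le> C * (N h)\<^sup>2))"

end

theory Submission imports Defs begin

text \<open>
  Distinct degrees are orthogonal, so it suffices to divide homogeneous elements, with a constant
  independent of the degree; finitely many degrees are harmless, since any division that is linear
  on a finite-dimensional space is bounded.

  For the high degrees, setting \<open>y = 1\<close> turns the homogeneous elements of the ideal into
  multiples of one polynomial \<open>g(t)\<close>, and the ideal contains homogeneous elements \<open>Y\<close> and \<open>X\<close>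
  with dehomogenizations \<open>g\<close> and \<open>g t^M\<close>. An element of degree \<open>n\<close> with dehomogenization \<open>g r\<close>
  is divided by cutting \<open>r = v + t^M a\<close> with \<open>degree v < M\<close>. The coefficients of \<open>v\<close> are
  computed from the lowest few coefficients of \<open>g r\<close> in a way independent of \<open>n\<close>, and the weights
  \<open>1 / (n choose k)\<close> decrease for \<open>k \<le> n / 2\<close>, so the norm of \<open>g v\<close> in degree \<open>n\<close> is bounded
  by a constant times that of \<open>g r\<close>.
\<close>

text \<open>
  For the ring as a module over itself this simplification rule reads
  \<open>a * (b * x) = (a * b) * x\<close>, which loops with \<open>mult.assoc\<close>.
\<close>

declare ideal.scale_scale [simp del]

section \<open>Homogeneous polynomials and homogeneous components\<close>

definition hom_deg :: "nat \<Rightarrow> cpoly2 \<Rightarrow> bool" where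
  "hom_deg n p \<longleftrightarrow> (\<forall>a b. coeff2 p a b \<noteq> 0 \<longrightarrow> a + b = n)"

text \<open>For \<open>c = coeff p\<close> with \<open>degree p \<le> n\<close> this is the
  homogenization of \<open>p(t)\<close> in degree \<open>n\<close>: \<open>t\<close> becomes
  \<open>x\<close>, and powers of \<open>y\<close> fill up the degree.\<close>

definition hpoly :: "nat \<Rightarrow> (nat \<Rightarrow> complex) \<Rightarrow> cpoly2" where
  "hpoly n c = (\<Sum>k\<le>n. monom (monom (c k) k) (n - k))"

definition component :: "nat \<Rightarrow> cpoly2 \<Rightarrow> cpoly2" where
  "component n p = hpoly n (\<lambda>k. coeff2 p k (n - k))"

lemma coeff2_eqI: "(\<And>a b. coeff2 p a b = coeff2 q a b) \<Longrightarrow> p = q"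
  by (simp add: coeff2_def poly_eq_iff)

lemma coeff2_add [simp]: "coeff2 (p + q) a b = coeff2 p a b + coeff2 q a b"
  and coeff2_diff [simp]: "coeff2 (p - q) a b = coeff2 p a b - coeff2 q a b"
  and coeff2_0 [simp]: "coeff2 0 a b = 0"
  by (simp_all add: coeff2_def)

lemma coeff2_sum: "coeff2 (\<Sum>i\<in>A. f i) a b = (\<Sum>i\<in>A. coeff2 (f i) a b)"
  by (simp add: coeff2_def coeff_sum)

lemma coeff2_smult [simp]: "coeff2 ([:[:c:]:] * p) a b = c * coeff2 p a b"
  by (simp add: coeff2_def)

lemma coeff2_hpoly: "coeff2 (hpoly n c) a b = (if a + b = n then c a else 0)"
proof -
  have "coeff2 (hpoly n c) a b = (\<Sum>k\<le>n. if k = a then (if a + b = n then c a else 0) else 0)"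
    unfolding hpoly_def coeff2_sum
    by (intro sum.cong) (auto simp: coeff2_def)
  then show ?thesis
    by (auto simp: sum.delta')
qed

lemma coeff2_component: "coeff2 (component n p) a b = (if a + b = n then coeff2 p a b else 0)"
  by (auto simp: component_def coeff2_hpoly)

lemma hom_deg_hpoly [simp]: "hom_deg n (hpoly n c)"
  by (simp add: hom_deg_def coeff2_hpoly)

lemma hom_deg_component [simp]: "hom_deg n (component n p)"
  by (simp add: component_def)

lemma hom_deg_add: "hom_deg n p \<Longrightarrow> hom_deg n q \<Longrightarrow> hom_deg n (p + q)"
  unfolding hom_deg_def coeff2_add by (metis add_0)

lemma hom_deg_diff: "hom_deg n p \<Longrightarrow> hom_deg n q \<Longrightarrow> hom_deg n (p - q)"
  unfolding hom_deg_def coeff2_diff by (metis diff_self)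

lemma coeff2_mult:
  "coeff2 (p * q) a b = (\<Sum>j\<le>b. \<Sum>i\<le>a. coeff2 p i j * coeff2 q (a - i) (b - j))"
  by (simp add: coeff2_def coeff_mult coeff_sum)

lemma hom_deg_mult:
  assumes "hom_deg m p" "hom_deg n q"
  shows "hom_deg (m + n) (p * q)"
  unfolding hom_deg_def
proof (intro allI impI)
  fix a b
  assume "coeff2 (p * q) a b \<noteq> 0"
  then obtain i j where ij: "j \<le> b" "i \<le> a" "coeff2 p i j * coeff2 q (a - i) (b - j) \<noteq> 0"
    unfolding coeff2_mult by (meson atMost_iff sum.not_neutral_contains_not_neutral)
  then have "i + j = m" "(a - i) + (b - j) = n"
    using assms by (auto simp: hom_deg_def)
  with ij show "a + b = m + n"
    by linarith
qed

lemma component_same: "hom_deg n p \<Longrightarrow> component n p = p"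
  by (rule coeff2_eqI) (auto simp: coeff2_component hom_deg_def)

lemma component_other: "hom_deg m p \<Longrightarrow> m \<noteq> n \<Longrightarrow> component n p = 0"
  by (rule coeff2_eqI) (auto simp: coeff2_component hom_deg_def)

lemma component_add: "component n (p + q) = component n p + component n q"
  by (rule coeff2_eqI) (auto simp: coeff2_component)

lemma component_sum: "component n (\<Sum>i\<in>A. f i) = (\<Sum>i\<in>A. component n (f i))"
  by (rule coeff2_eqI) (auto simp: coeff2_component coeff2_sum)

lemma ex_coeff2_bound: "\<exists>D. \<forall>a b. coeff2 p a b \<noteq> 0 \<longrightarrow> a \<le> D \<and> b \<le> D"
proof -
  obtain m where m: "\<And>b. degree (coeff p b) \<le> m"
    using ex_degree_bound by blast
  have "a \<le> max m (degree p) \<and> b \<le> max m (degree p)" if "coeff2 p a b \<noteq> 0" for a b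
  proof -
    have "a \<le> degree (coeff p b)" "b \<le> degree p"
      using that by (auto simp: coeff2_def intro!: le_degree)
    then show ?thesis
      using m[of b] by linarith
  qed
  then show ?thesis by blast
qed

text \<open>Every sufficiently large cutoff is provided, so that two polynomials can be expanded up
  to the same degree.\<close>

lemma ex_sum_component: "\<exists>L. \<forall>l\<ge>L. p = (\<Sum>n\<le>l. component n p)"
proof -
  obtain D where D: "\<And>a b. coeff2 p a b \<noteq> 0 \<Longrightarrow> a \<le> D \<and> b \<le> D"
    using ex_coeff2_bound by blast
  have "p = (\<Sum>n\<le>l. component n p)" if "l \<ge> 2 * D" for l
  proof (rule coeff2_eqI)
    fix a b
    have "coeff2 (\<Sum>n\<le>l. component n p) a b = (if a + b \<le> l then coeff2 p a b else 0)"
      by (simp add: coeff2_sum coeff2_component)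
    then show "coeff2 p a b = coeff2 (\<Sum>n\<le>l. component n p) a b"
      using D[of a b] that by (cases "coeff2 p a b = 0") auto
  qed
  then show ?thesis by blast
qed

text \<open>Both factors are expanded up to a common cutoff. A product of components of degrees
  \<open>i\<close> and \<open>j\<close> has degree \<open>i + j\<close>, so
  \<open>component n\<close> keeps exactly the pairs with \<open>i + j = n\<close>.\<close>

lemma component_mult:
  "\<exists>L. component n (p * q) =
     (\<Sum>i\<le>L. \<Sum>j\<le>L. if i + j = n then component i p * component j q else 0)"
proof -
  obtain L1 where L1: "\<forall>l\<ge>L1. p = (\<Sum>n\<le>l. component n p)"
    using ex_sum_component by blast
  obtain L2 where L2: "\<forall>l\<ge>L2. q = (\<Sum>n\<le>l. component n q)"
    using ex_sum_component by blast
  define L where "L = max L1 L2"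
  have "p = (\<Sum>i\<le>L. component i p)" "q = (\<Sum>j\<le>L. component j q)"
    using L1 L2 by (simp_all only: L_def max.cobounded1 max.cobounded2)
  then have "p * q = (\<Sum>i\<le>L. component i p) * (\<Sum>j\<le>L. component j q)"
    by (rule arg_cong2)
  also have "\<dots> = (\<Sum>i\<le>L. \<Sum>j\<le>L. component i p * component j q)"
    by (rule sum_product)
  finally have "component n (p * q) = (\<Sum>i\<le>L. \<Sum>j\<le>L. component n (component i p * component j q))"
    by (simp add: component_sum)
  also have "\<dots> = (\<Sum>i\<le>L. \<Sum>j\<le>L. if i + j = n then component i p * component j q else 0)"
  proof (intro sum.cong refl)
    fix i j
    have "hom_deg (i + j) (component i p * component j q)"
      by (intro hom_deg_mult hom_deg_component)
    then show "component n (component i p * component j q) =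
        (if i + j = n then component i p * component j q else 0)"
      using component_same component_other by auto
  qed
  finally show ?thesis by blast
qed

text \<open>By the product formula, the polynomials all of whose components lie in \<open>I\<close>
  form an ideal, and this ideal contains the homogeneous generators of \<open>I\<close>.\<close>

lemma component_in_ideal:
  assumes "homogeneous_ideal I" "p \<in> I"
  shows "component n p \<in> I"
proof -
  obtain S where S: "\<And>f. f \<in> S \<Longrightarrow> homogeneous f" and I: "I = ideal_generated S"
    using assms by (auto simp: homogeneous_ideal_def)
  have sub: "is_ideal I"
    unfolding I by (rule ideal.subspace_span)
  have "\<forall>n. component n p \<in> I" if "p \<in> ideal_generated S" for p
    using that
  proof (induction rule: ideal.span_induct)
    case base
    show ?case
      unfolding ideal.subspace_def
    proof (intro conjI ballI allI)
      have "component n 0 = 0" for n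
        by (rule coeff2_eqI) (simp add: coeff2_component)
      then show "0 \<in> {x. \<forall>n. component n x \<in> I}"
        using ideal.subspace_0[OF sub] by simp
    next
      fix x y assume "x \<in> {x. \<forall>n. component n x \<in> I}" "y \<in> {x. \<forall>n. component n x \<in> I}"
      then show "x + y \<in> {x. \<forall>n. component n x \<in> I}"
        using ideal.subspace_add[OF sub] by (simp add: component_add)
    next
      fix c x assume x: "x \<in> {x. \<forall>n. component n x \<in> I}"
      have "component n (c * x) \<in> I" for n
      proof -
        obtain L where L: "component n (c * x) =
            (\<Sum>i\<le>L. \<Sum>j\<le>L. if i + j = n then component i c * component j x else 0)"
          using component_mult by blast
        show ?thesis
          unfolding L using x
          by (intro ideal.subspace_sum[OF sub])
             (auto intro: ideal.subspace_scale[OF sub] ideal.subspace_0[OF sub])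
      qed
      then show "c * x \<in> {x. \<forall>n. component n x \<in> I}" by simp
    qed
  next
    case (step f)
    obtain m where m: "hom_deg m f"
      using S[OF step] by (auto simp: homogeneous_def hom_deg_def)
    have "f \<in> I"
      unfolding I using step by (rule ideal.span_base)
    then have "component n f \<in> I" for n
      using component_same[OF m] component_other[OF m, of n] ideal.subspace_0[OF sub]
      by (cases "m = n") auto
    then show ?case by simp
  qed
  then show ?thesis
    using assms(2) I by simp
qed

section \<open>Dehomogenization by setting \<open>y = 1\<close>\<close>

text \<open>The outer variable of \<open>cpoly2\<close> is \<open>y\<close>, so
  \<open>poly p 1\<close> is a polynomial in \<open>x\<close>. Distinct monomials of the same degree
  have distinct exponents of \<open>x\<close>, so no terms merge.\<close>

lemma coeff_dehom:
  assumes "hom_deg n p"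
  shows "coeff (poly p 1) k = (if k \<le> n then coeff2 p k (n - k) else 0)"
proof -
  have "coeff (poly p 1) k = (\<Sum>i\<le>degree p. coeff2 p k i)"
    by (simp add: poly_altdef coeff_sum coeff2_def)
  also have "\<dots> = (\<Sum>i\<le>degree p. if i = n - k then (if k \<le> n then coeff2 p k (n - k) else 0) else 0)"
    using assms by (intro sum.cong refl) (force simp: hom_deg_def)
  also have "\<dots> = (if k \<le> n then coeff2 p k (n - k) else 0)"
    by (auto simp: coeff2_def coeff_eq_0)
  finally show ?thesis .
qed

lemma degree_dehom: "hom_deg n p \<Longrightarrow> degree (poly p 1) \<le> n"
  by (rule degree_le) (simp add: coeff_dehom)

lemma dehom_inject:
  assumes "hom_deg n p" "hom_deg n q" "poly p 1 = poly q 1"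
  shows "p = q"
proof (rule coeff2_eqI)
  fix a b
  show "coeff2 p a b = coeff2 q a b"
  proof (cases "a + b = n")
    case True
    then have "b = n - a" "a \<le> n" by auto
    then show ?thesis
      using coeff_dehom[OF assms(1), of a] coeff_dehom[OF assms(2), of a] assms(3) by simp
  next
    case False
    then show ?thesis
      using assms by (metis hom_deg_def)
  qed
qed

lemma dehom_eq_0: "hom_deg n p \<Longrightarrow> poly p 1 = 0 \<Longrightarrow> p = 0"
  by (rule dehom_inject[of n]) (auto simp: hom_deg_def)

lemma dehom_hpoly:
  assumes "degree p \<le> n"
  shows "poly (hpoly n (coeff p)) 1 = p"
  by (rule poly_eqI) (use assms in \<open>auto simp: coeff_dehom[OF hom_deg_hpoly] coeff2_hpoly coeff_eq_0\<close>)

section \<open>The \<open>H2_norm\<close> in terms of coefficients\<close>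

definition H2_weight :: "nat \<Rightarrow> nat \<Rightarrow> real" where
  "H2_weight a b = fact a * fact b / fact (a + b)"

lemma H2_weight_pos: "H2_weight a b > 0"
  by (simp add: H2_weight_def)

text \<open>The box may exceed the support, so the norms of several polynomials become sums over one
  index set.\<close>

lemma H2_norm_sq_box:
  assumes "\<forall>a b. coeff2 p a b \<noteq> 0 \<longrightarrow> a \<le> D \<and> b \<le> D"
  shows "(H2_norm p)\<^sup>2 = (\<Sum>b\<le>D. \<Sum>a\<le>D. H2_weight a b * (cmod (coeff2 p a b))\<^sup>2)"
proof -
  have d1: "degree (coeff p b) \<le> D" for b
    using assms unfolding coeff2_def by (metis degree_le not_less)
  have d2: "degree p \<le> D"
    using assms unfolding coeff2_def by (metis coeff_0 degree_le not_less poly_eqI)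
  have "H2_inner p p = of_real (\<Sum>b\<le>D. \<Sum>a\<le>D. H2_weight a b * (cmod (coeff2 p a b))\<^sup>2)"
    unfolding H2_inner_box[OF d2 d1] of_real_sum
    by (intro sum.cong refl) (simp only: H2_weight_def of_real_mult complex_norm_square)
  moreover have "0 \<le> (\<Sum>b\<le>D. \<Sum>a\<le>D. H2_weight a b * (cmod (coeff2 p a b))\<^sup>2)"
    by (intro sum_nonneg mult_nonneg_nonneg less_imp_le[OF H2_weight_pos]) auto
  ultimately show ?thesis
    by (simp add: H2_norm_def)
qed

lemma norm_add_sq_le: "(cmod (u + v))\<^sup>2 \<le> 2 * ((cmod u)\<^sup>2 + (cmod v)\<^sup>2)"
proof -
  have "(cmod (u + v))\<^sup>2 \<le> (cmod u + cmod v)\<^sup>2"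
    by (simp add: norm_triangle_ineq power_mono)
  also have "\<dots> \<le> 2 * ((cmod u)\<^sup>2 + (cmod v)\<^sup>2)"
    using zero_le_power2[of "cmod u - cmod v"] by (simp add: power2_sum power2_diff)
  finally show ?thesis .
qed

text \<open>With squares and the factor 2, the estimate holds coefficient by coefficient.\<close>

lemma H2_norm_add_sq_le: "(H2_norm (p + q))\<^sup>2 \<le> 2 * ((H2_norm p)\<^sup>2 + (H2_norm q)\<^sup>2)"
proof -
  obtain D1 where D1: "\<forall>a b. coeff2 p a b \<noteq> 0 \<longrightarrow> a \<le> D1 \<and> b \<le> D1"
    using ex_coeff2_bound by blast
  obtain D2 where D2: "\<forall>a b. coeff2 q a b \<noteq> 0 \<longrightarrow> a \<le> D2 \<and> b \<le> D2"
    using ex_coeff2_bound by blast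
  define D where "D = max D1 D2"
  have P: "\<forall>a b. coeff2 p a b \<noteq> 0 \<longrightarrow> a \<le> D \<and> b \<le> D"
    using D1 by (auto simp: D_def le_max_iff_disj)
  have Q: "\<forall>a b. coeff2 q a b \<noteq> 0 \<longrightarrow> a \<le> D \<and> b \<le> D"
    using D2 by (auto simp: D_def le_max_iff_disj)
  have PQ: "\<forall>a b. coeff2 (p + q) a b \<noteq> 0 \<longrightarrow> a \<le> D \<and> b \<le> D"
  proof (intro allI impI)
    fix a b assume "coeff2 (p + q) a b \<noteq> 0"
    then have "coeff2 p a b \<noteq> 0 \<or> coeff2 q a b \<noteq> 0" by auto
    then show "a \<le> D \<and> b \<le> D" using P Q by blast
  qed
  have "(\<Sum>b\<le>D. \<Sum>a\<le>D. H2_weight a b * (cmod (coeff2 (p + q) a b))\<^sup>2)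
      \<le> (\<Sum>b\<le>D. \<Sum>a\<le>D. H2_weight a b * (2 * ((cmod (coeff2 p a b))\<^sup>2 + (cmod (coeff2 q a b))\<^sup>2)))"
    unfolding coeff2_add
    by (intro sum_mono mult_left_mono norm_add_sq_le less_imp_le[OF H2_weight_pos])
  also have "\<dots> = 2 * ((\<Sum>b\<le>D. \<Sum>a\<le>D. H2_weight a b * (cmod (coeff2 p a b))\<^sup>2)
      + (\<Sum>b\<le>D. \<Sum>a\<le>D. H2_weight a b * (cmod (coeff2 q a b))\<^sup>2))"
    by (simp only: mult.left_commute[of _ 2] distrib_left sum.distrib sum_distrib_left)
  finally show ?thesis
    by (simp only: H2_norm_sq_box[OF P] H2_norm_sq_box[OF Q] H2_norm_sq_box[OF PQ])
qed

lemma H2_norm_scale_sq: "(H2_norm ([:[:c:]:] * p))\<^sup>2 = (cmod c)\<^sup>2 * (H2_norm p)\<^sup>2"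
proof -
  obtain D where D: "\<forall>a b. coeff2 p a b \<noteq> 0 \<longrightarrow> a \<le> D \<and> b \<le> D"
    using ex_coeff2_bound by blast
  then have D': "\<forall>a b. coeff2 ([:[:c:]:] * p) a b \<noteq> 0 \<longrightarrow> a \<le> D \<and> b \<le> D"
    unfolding coeff2_smult mult_eq_0_iff by blast
  have "(H2_norm ([:[:c:]:] * p))\<^sup>2 =
      (\<Sum>b\<le>D. \<Sum>a\<le>D. (cmod c)\<^sup>2 * (H2_weight a b * (cmod (coeff2 p a b))\<^sup>2))"
    unfolding H2_norm_sq_box[OF D'] coeff2_smult
    by (intro sum.cong refl) (simp only: norm_mult power_mult_distrib mult_ac)
  also have "\<dots> = (cmod c)\<^sup>2 * (H2_norm p)\<^sup>2"
    by (simp only: H2_norm_sq_box[OF D] sum_distrib_left)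
  finally show ?thesis .
qed

lemma H2_norm_0 [simp]: "H2_norm 0 = 0"
  by (simp add: H2_norm_def H2_inner_def coeff2_def)

text \<open>The left side is one of the nonnegative terms that make up the squared norm. Thus each
  coefficient is a bounded functional.\<close>

lemma coeff2_le_H2_norm: "H2_weight a b * (cmod (coeff2 p a b))\<^sup>2 \<le> (H2_norm p)\<^sup>2"
proof (cases "coeff2 p a b = 0")
  case False
  obtain D where D: "\<forall>a b. coeff2 p a b \<noteq> 0 \<longrightarrow> a \<le> D \<and> b \<le> D"
    using ex_coeff2_bound by blast
  have nn: "0 \<le> H2_weight i j * (cmod (coeff2 p i j))\<^sup>2" for i j
    using H2_weight_pos[of i j] by simp
  have "H2_weight a b * (cmod (coeff2 p a b))\<^sup>2 \<le> (\<Sum>i\<le>D. H2_weight i b * (cmod (coeff2 p i b))\<^sup>2)"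
    by (rule member_le_sum) (use D False nn in auto)
  also have "\<dots> \<le> (\<Sum>j\<le>D. \<Sum>i\<le>D. H2_weight i j * (cmod (coeff2 p i j))\<^sup>2)"
    by (rule member_le_sum) (use D False nn in \<open>auto intro: sum_nonneg\<close>)
  finally show ?thesis
    by (simp only: H2_norm_sq_box[OF D])
qed simp

text \<open>Pythagoras: an exponent pair \<open>(a, b)\<close> can occur only in the summand with
  \<open>n = a + b\<close>.\<close>

lemma H2_norm_sq_sum_hom:
  assumes "finite A" and Z: "\<And>n. n \<in> A \<Longrightarrow> hom_deg n (Z n)"
  shows "(H2_norm (\<Sum>n\<in>A. Z n))\<^sup>2 = (\<Sum>n\<in>A. (H2_norm (Z n))\<^sup>2)"
proof -
  \<comment> \<open>The sum of the degrees in \<open>A\<close> dominates each of them, which gives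
    one box for all summands.\<close>
  define D where "D = (\<Sum>n\<in>A. n)"
  have D: "a \<le> D \<and> b \<le> D" if "n \<in> A" "coeff2 (Z n) a b \<noteq> 0" for n a b
  proof -
    have "a + b = n"
      using Z that by (auto simp: hom_deg_def)
    moreover have "n \<le> D"
      unfolding D_def using assms(1) that(1) by (intro member_le_sum) auto
    ultimately show ?thesis by linarith
  qed
  have DS: "\<forall>a b. coeff2 (\<Sum>n\<in>A. Z n) a b \<noteq> 0 \<longrightarrow> a \<le> D \<and> b \<le> D"
    using D unfolding coeff2_sum by (meson sum.not_neutral_contains_not_neutral)
  have single: "(cmod (\<Sum>n\<in>A. coeff2 (Z n) a b))\<^sup>2 = (\<Sum>n\<in>A. (cmod (coeff2 (Z n) a b))\<^sup>2)" for a b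
  proof -
    have z: "coeff2 (Z n) a b = (if n = a + b then coeff2 (Z (a + b)) a b else 0)" if "n \<in> A" for n
      using Z[OF that] by (auto simp: hom_deg_def)
    have "(\<Sum>n\<in>A. coeff2 (Z n) a b) = (if a + b \<in> A then coeff2 (Z (a + b)) a b else 0)"
      using assms(1) by (subst sum.cong[OF refl z]) auto
    moreover have "(\<Sum>n\<in>A. (cmod (coeff2 (Z n) a b))\<^sup>2) =
        (\<Sum>n\<in>A. if n = a + b then (cmod (coeff2 (Z (a + b)) a b))\<^sup>2 else 0)"
      by (intro sum.cong refl) (simp add: z)
    ultimately show ?thesis
      using assms(1) by simp
  qed
  have "(H2_norm (\<Sum>n\<in>A. Z n))\<^sup>2 =
      (\<Sum>b\<le>D. \<Sum>a\<le>D. \<Sum>n\<in>A. H2_weight a b * (cmod (coeff2 (Z n) a b))\<^sup>2)"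
    by (simp only: H2_norm_sq_box[OF DS] coeff2_sum single sum_distrib_left)
  also have "\<dots> = (\<Sum>n\<in>A. \<Sum>b\<le>D. \<Sum>a\<le>D. H2_weight a b * (cmod (coeff2 (Z n) a b))\<^sup>2)"
    by (subst sum.swap[where A = "{..D}" and B = A], subst sum.swap[where B = A]) (rule refl)
  also have "\<dots> = (\<Sum>n\<in>A. (H2_norm (Z n))\<^sup>2)"
    using D by (intro sum.cong refl H2_norm_sq_box[symmetric]) blast
  finally show ?thesis .
qed

section \<open>Bounded division and the finite-dimensional case\<close>

text \<open>The bound \<open>K\<close> is a plain number, not a multiple of the norm of
  \<open>h\<close>, so that a piece of a polynomial can be bounded by the norm of the whole.\<close>

definition divisible_within :: "cpoly2 set \<Rightarrow> real \<Rightarrow> cpoly2 \<Rightarrow> bool" where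
  "divisible_within F K h \<longleftrightarrow>
     (\<exists>a. h = (\<Sum>f\<in>F. a f * f) \<and> (\<Sum>f\<in>F. (H2_norm (a f * f))\<^sup>2) \<le> K)"

lemma divisible_within_mono: "divisible_within F K h \<Longrightarrow> K \<le> L \<Longrightarrow> divisible_within F L h"
  unfolding divisible_within_def by (blast intro: order_trans)

lemma divisible_within_singleton: "(H2_norm (a * f))\<^sup>2 \<le> K \<Longrightarrow> divisible_within {f} K (a * f)"
  unfolding divisible_within_def by (intro exI[of _ "\<lambda>_. a"]) simp

text \<open>The multipliers are extended by zero and added, so generators common to \<open>F\<close>
  and \<open>G\<close> are allowed. The factor 2 is that of
  \<open>H2_norm_add_sq_le\<close>.\<close>

lemma divisible_within_Un:
  assumes "finite F" "finite G" and F: "divisible_within F K h" and G: "divisible_within G L k"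
  shows "divisible_within (F \<union> G) (2 * (K + L)) (h + k)"
proof -
  obtain a where a: "h = (\<Sum>f\<in>F. a f * f)" "(\<Sum>f\<in>F. (H2_norm (a f * f))\<^sup>2) \<le> K"
    using F unfolding divisible_within_def by blast
  obtain b where b: "k = (\<Sum>f\<in>G. b f * f)" "(\<Sum>f\<in>G. (H2_norm (b f * f))\<^sup>2) \<le> L"
    using G unfolding divisible_within_def by blast
  define a' b' where "a' f = (if f \<in> F then a f else 0)" and "b' f = (if f \<in> G then b f else 0)" for f
  have "(\<Sum>f\<in>F \<union> G. a' f * f) = h"
    unfolding a(1) using assms(1,2) by (intro sum.mono_neutral_cong_right) (auto simp: a'_def)
  moreover have "(\<Sum>f\<in>F \<union> G. b' f * f) = k"
    unfolding b(1) using assms(1,2) by (intro sum.mono_neutral_cong_right) (auto simp: b'_def)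
  ultimately have hk: "h + k = (\<Sum>f\<in>F \<union> G. (a' f + b' f) * f)"
    by (simp add: distrib_right sum.distrib)
  have a': "(\<Sum>f\<in>F \<union> G. (H2_norm (a' f * f))\<^sup>2) = (\<Sum>f\<in>F. (H2_norm (a f * f))\<^sup>2)"
    using assms(1,2) by (intro sum.mono_neutral_cong_right) (auto simp: a'_def)
  have b': "(\<Sum>f\<in>F \<union> G. (H2_norm (b' f * f))\<^sup>2) = (\<Sum>f\<in>G. (H2_norm (b f * f))\<^sup>2)"
    using assms(1,2) by (intro sum.mono_neutral_cong_right) (auto simp: b'_def)
  have "(\<Sum>f\<in>F \<union> G. (H2_norm ((a' f + b' f) * f))\<^sup>2)
      \<le> (\<Sum>f\<in>F \<union> G. 2 * ((H2_norm (a' f * f))\<^sup>2 + (H2_norm (b' f * f))\<^sup>2))"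
    unfolding distrib_right by (intro sum_mono H2_norm_add_sq_le)
  also have "\<dots> \<le> 2 * (K + L)"
    using a(2) b(2) unfolding sum_distrib_left[symmetric] sum.distrib a' b' by simp
  finally show ?thesis
    unfolding divisible_within_def using hk by (intro exI[of _ "\<lambda>f. a' f + b' f"]) simp
qed

text \<open>Gaussian elimination on a linear space \<open>W\<close> of polynomials supported in
  \<open>E\<close>. If some \<open>f\<close> in \<open>W\<close> has a nonzero coefficient at the
  pivot exponent, subtracting a multiple of \<open>f\<close> from \<open>h\<close> kills that
  coefficient and leaves a smaller support set. The multiple is determined by the pivot coefficient
  of \<open>h\<close>, which the norm of \<open>h\<close> controls.\<close>

lemma finite_support_division:
  assumes "finite E" and "0 \<in> W"
    and "\<And>c p q. p \<in> W \<Longrightarrow> q \<in> W \<Longrightarrow> p + [:[:c:]:] * q \<in> W"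
    and "\<And>p a b. p \<in> W \<Longrightarrow> coeff2 p a b \<noteq> 0 \<Longrightarrow> (a, b) \<in> E"
  shows "\<exists>F C. finite F \<and> F \<subseteq> W \<and> 0 \<le> C \<and> (\<forall>h\<in>W. divisible_within F (C * (H2_norm h)\<^sup>2) h)"
  using assms
proof (induction E arbitrary: W rule: finite_induct)
  case empty
  then have "h = 0" if "h \<in> W" for h
    using that by (intro coeff2_eqI) force
  then have "\<forall>h\<in>W. divisible_within {} (0 * (H2_norm h)\<^sup>2) h"
    by (auto simp: divisible_within_def)
  then show ?case
    by (intro exI[of _ "{}"] exI[of _ 0]) simp
next
  case (insert e E)
  obtain i j where e: "e = (i, j)" by force
  show ?case
  proof (cases "\<exists>f\<in>W. coeff2 f i j \<noteq> 0")
    case False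
    show ?thesis
    proof (rule insert.IH)
      show "(a, b) \<in> E" if "p \<in> W" "coeff2 p a b \<noteq> 0" for p a b
        using insert.prems(3)[OF that] that False e by auto
    qed (fact insert.prems(1,2))+
  next
    case True
    then obtain f where f: "f \<in> W" "coeff2 f i j \<noteq> 0" by blast
    define W' where "W' = {h \<in> W. coeff2 h i j = 0}"
    have "\<exists>F C. finite F \<and> F \<subseteq> W' \<and> 0 \<le> C \<and> (\<forall>h\<in>W'. divisible_within F (C * (H2_norm h)\<^sup>2) h)"
    proof (rule insert.IH)
      show "0 \<in> W'"
        using insert.prems(1) by (simp add: W'_def)
      show "p + [:[:c:]:] * q \<in> W'" if "p \<in> W'" "q \<in> W'" for c p q
        using that insert.prems(2)[of p q c] unfolding W'_def
        by (simp only: mem_Collect_eq coeff2_add coeff2_smult) simp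
      show "(a, b) \<in> E" if "p \<in> W'" "coeff2 p a b \<noteq> 0" for p a b
        using insert.prems(3)[of p a b] that e unfolding W'_def by auto
    qed
    then obtain F C where F: "finite F" "F \<subseteq> W'" "0 \<le> C"
      "\<And>h. h \<in> W' \<Longrightarrow> divisible_within F (C * (H2_norm h)\<^sup>2) h"
      by blast
    \<comment> \<open>By \<open>coeff2_le_H2_norm\<close>, this is the factor by which the squared
      norm of \<open>h\<close> bounds that of the subtracted multiple of \<open>f\<close>.\<close>
    define A where "A = (H2_norm f)\<^sup>2 / ((cmod (coeff2 f i j))\<^sup>2 * H2_weight i j)"
    have A0: "A \<ge> 0"
      unfolding A_def using H2_weight_pos[of i j] by simp
    \<comment> \<open>\<open>A\<close> accounts for the multiple of \<open>f\<close>,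
      \<open>C * (2 * (1 + A))\<close> for the reduced element \<open>k\<close>, and the outer 2
      comes from \<open>divisible_within_Un\<close>.\<close>
    define B where "B = 2 * (A + C * (2 * (1 + A)))"
    have "divisible_within ({f} \<union> F) (B * (H2_norm h)\<^sup>2) h" if h: "h \<in> W" for h
    proof -
      define c where "c = coeff2 h i j / coeff2 f i j"
      define k where "k = h + [:[:-c:]:] * f"
      have k: "k \<in> W'"
        unfolding W'_def k_def using insert.prems(2)[OF h f(1), of "-c"] f(2)
        by (simp only: mem_Collect_eq coeff2_add coeff2_smult) (simp add: c_def)
      have cf: "(H2_norm ([:[:c:]:] * f))\<^sup>2 \<le> A * (H2_norm h)\<^sup>2"
      proof -
        have "(cmod c)\<^sup>2 * (H2_norm f)\<^sup>2 = A * (H2_weight i j * (cmod (coeff2 h i j))\<^sup>2)"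
          using f(2) H2_weight_pos[of i j]
          by (simp add: A_def c_def norm_divide power_divide)
        also have "\<dots> \<le> A * (H2_norm h)\<^sup>2"
          by (intro mult_left_mono coeff2_le_H2_norm A0)
        finally show ?thesis
          unfolding H2_norm_scale_sq .
      qed
      have "(H2_norm k)\<^sup>2 \<le> 2 * ((H2_norm h)\<^sup>2 + (H2_norm ([:[:-c:]:] * f))\<^sup>2)"
        unfolding k_def by (rule H2_norm_add_sq_le)
      also have "(H2_norm ([:[:-c:]:] * f))\<^sup>2 = (H2_norm ([:[:c:]:] * f))\<^sup>2"
        unfolding H2_norm_scale_sq by simp
      finally have "(H2_norm k)\<^sup>2 \<le> 2 * (1 + A) * (H2_norm h)\<^sup>2"
        using cf unfolding distrib_left distrib_right by linarith
      then have "C * (H2_norm k)\<^sup>2 \<le> C * (2 * (1 + A) * (H2_norm h)\<^sup>2)"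
        using F(3) by (intro mult_left_mono)
      then have "divisible_within F (C * (2 * (1 + A) * (H2_norm h)\<^sup>2)) k"
        by (rule divisible_within_mono[OF F(4)[OF k]])
      from divisible_within_Un[OF _ F(1) divisible_within_singleton[OF cf] this]
      have "divisible_within ({f} \<union> F)
          (2 * (A * (H2_norm h)\<^sup>2 + C * (2 * (1 + A) * (H2_norm h)\<^sup>2))) ([:[:c:]:] * f + k)"
        by blast
      moreover have "[:[:c:]:] * f + k = h"
        unfolding k_def by (intro coeff2_eqI) (simp only: coeff2_add coeff2_smult, simp)
      ultimately show ?thesis
        by (simp only: B_def distrib_left distrib_right mult.assoc)
    qed
    moreover have "B \<ge> 0"
      using A0 F(3) by (simp add: B_def)
    ultimately show ?thesis
      using F(1,2) f(1) by (intro exI[of _ "{f} \<union> F"] exI[of _ B]) (auto simp: W'_def)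
  qed
qed

section \<open>Degree-dependent norms of polynomials in one variable\<close>

text \<open>The squared \<open>H2_norm\<close> of a form of degree \<open>n\<close>, read off its
  dehomogenization: for \<open>k \<le> n\<close>, \<open>H2_weight k (n - k)\<close> is the
  reciprocal of \<open>n choose k\<close>.\<close>

definition deg_norm_sq :: "nat \<Rightarrow> complex poly \<Rightarrow> real" where
  "deg_norm_sq n p = (\<Sum>k\<le>n. (cmod (coeff p k))\<^sup>2 / (n choose k))"

lemma H2_norm_sq_dehom:
  assumes "hom_deg n Z"
  shows "(H2_norm Z)\<^sup>2 = deg_norm_sq n (poly Z 1)"
proof -
  have "\<forall>a b. coeff2 Z a b \<noteq> 0 \<longrightarrow> a \<le> n \<and> b \<le> n"
    using assms unfolding hom_deg_def by fastforce
  then have "(H2_norm Z)\<^sup>2 = (\<Sum>b\<le>n. \<Sum>a\<le>n. H2_weight a b * (cmod (coeff2 Z a b))\<^sup>2)"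
    by (rule H2_norm_sq_box)
  also have "\<dots> = (\<Sum>a\<le>n. \<Sum>b\<le>n. H2_weight a b * (cmod (coeff2 Z a b))\<^sup>2)"
    by (rule sum.swap)
  also have "\<dots> = (\<Sum>a\<le>n. \<Sum>b\<le>n. if b = n - a then (cmod (coeff (poly Z 1) a))\<^sup>2 / (n choose a) else 0)"
  proof (intro sum.cong refl)
    fix a b assume "a \<in> {..n}" "b \<in> {..n}"
    moreover have "coeff2 Z a b = 0" if "a + b \<noteq> n"
      using assms that unfolding hom_deg_def by blast
    ultimately show "H2_weight a b * (cmod (coeff2 Z a b))\<^sup>2 =
        (if b = n - a then (cmod (coeff (poly Z 1) a))\<^sup>2 / (n choose a) else 0)"
      by (cases "a + b = n") (auto simp: coeff_dehom[OF assms] H2_weight_def binomial_fact)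
  qed
  also have "\<dots> = deg_norm_sq n (poly Z 1)"
    by (simp add: deg_norm_sq_def)
  finally show ?thesis .
qed

lemma deg_norm_sq_add_le:
  "deg_norm_sq n (p + q) \<le> 2 * (deg_norm_sq n p + deg_norm_sq n q)"
proof -
  have "deg_norm_sq n (p + q)
      \<le> (\<Sum>k\<le>n. 2 * ((cmod (coeff p k))\<^sup>2 + (cmod (coeff q k))\<^sup>2) / (n choose k))"
    unfolding deg_norm_sq_def coeff_add
    by (intro sum_mono divide_right_mono norm_add_sq_le) simp
  also have "\<dots> = 2 * (deg_norm_sq n p + deg_norm_sq n q)"
    by (simp add: deg_norm_sq_def sum_distrib_left sum.distrib add_divide_distrib distrib_left)
  finally show ?thesis .
qed

lemma deg_norm_sq_minus [simp]: "deg_norm_sq n (- p) = deg_norm_sq n p"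
  by (simp add: deg_norm_sq_def)

lemma deg_norm_sq_nonneg: "deg_norm_sq n p \<ge> 0"
  by (simp add: deg_norm_sq_def sum_nonneg)

text \<open>
  For large \<open>n\<close> the norm of \<open>g\<close> in degree \<open>n\<close> is dominated by its lowest coefficient.
\<close>

lemma deg_norm_sq_const_term:
  assumes "g \<noteq> 0"
  shows "\<exists>C\<ge>0. \<exists>N. \<forall>n\<ge>N. \<forall>r. deg_norm_sq n (g * [:coeff r 0:]) \<le> C * deg_norm_sq n (g * r)"
proof -
  \<comment> \<open>The order of vanishing of \<open>g\<close> at 0, since the constant term of
    \<open>g\<close> may be zero.\<close>
  define e where "e = (LEAST i. coeff g i \<noteq> 0)"
  have e: "coeff g e \<noteq> 0"
    unfolding e_def using assms by (metis (mono_tags, lifting) LeastI leading_coeff_0_iff)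
  have e_less: "coeff g i = 0" if "i < e" for i
    using that not_less_Least unfolding e_def by blast
  have ed: "e \<le> degree g"
    using e by (rule le_degree)
  define S where "S = (\<Sum>k\<le>degree g. (cmod (coeff g k))\<^sup>2)"
  have S0: "S \<ge> 0"
    by (simp add: S_def sum_nonneg)
  \<comment> \<open>The coefficient of \<open>t^e\<close> in \<open>g * r\<close> is
    \<open>coeff g e * coeff r 0\<close>, so the norm of \<open>g * r\<close> controls
    \<open>coeff r 0\<close>. As \<open>degree g \<le> n / 2\<close>, the binomials
    \<open>n choose k\<close> do not decrease for \<open>e \<le> k \<le> degree g\<close>, so the
    largest weight on the support of \<open>g\<close> is the one at \<open>e\<close>.\<close>
  have "deg_norm_sq n (g * [:coeff r 0:]) \<le> S / (cmod (coeff g e))\<^sup>2 * deg_norm_sq n (g * r)"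
    if n: "n \<ge> 2 * degree g" for n r
  proof -
    define c where "c = coeff r 0"
    have "coeff (g * r) e = (\<Sum>i\<le>e. if i = e then coeff g e * c else 0)"
      unfolding coeff_mult by (intro sum.cong refl) (auto simp: e_less c_def)
    then have ce: "coeff (g * r) e = coeff g e * c"
      by simp
    have "deg_norm_sq n (g * [:c:]) = (\<Sum>k\<le>n. (cmod c)\<^sup>2 * (cmod (coeff g k))\<^sup>2 / (n choose k))"
      by (simp add: deg_norm_sq_def norm_mult power_mult_distrib)
    also have "\<dots> \<le> (\<Sum>k\<le>n. (cmod c)\<^sup>2 * (cmod (coeff g k))\<^sup>2 / (n choose e))"
    proof (intro sum_mono)
      fix k
      show "(cmod c)\<^sup>2 * (cmod (coeff g k))\<^sup>2 / (n choose k) \<le> (cmod c)\<^sup>2 * (cmod (coeff g k))\<^sup>2 / (n choose e)"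
      proof (cases "e \<le> k \<and> k \<le> degree g")
        case True
        then have "(n choose e) \<le> (n choose k)"
          using n by (intro binomial_mono) auto
        moreover have "(n choose e) > 0" "(n choose k) > 0"
          using True n by (auto intro!: zero_less_binomial)
        ultimately show ?thesis
          by (intro divide_left_mono mult_pos_pos) auto
      next
        case False
        then have "coeff g k = 0"
          using e_less by (auto simp: coeff_eq_0 not_le)
        then show ?thesis by simp
      qed
    qed
    also have "\<dots> = (cmod c)\<^sup>2 / (n choose e) * (\<Sum>k\<le>n. (cmod (coeff g k))\<^sup>2)"
      by (simp add: sum_distrib_left sum_divide_distrib)
    also have "(\<Sum>k\<le>n. (cmod (coeff g k))\<^sup>2) = S"
      unfolding S_def using n by (intro sum.mono_neutral_right) (auto simp: coeff_eq_0)
    also have "(cmod c)\<^sup>2 / (n choose e) * S =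
        S / (cmod (coeff g e))\<^sup>2 * ((cmod (coeff (g * r) e))\<^sup>2 / (n choose e))"
      using e by (simp add: ce norm_mult power_mult_distrib)
    also have "\<dots> \<le> S / (cmod (coeff g e))\<^sup>2 * deg_norm_sq n (g * r)"
      unfolding deg_norm_sq_def using ed n S0
      by (intro mult_left_mono member_le_sum) auto
    finally show ?thesis
      by (simp add: c_def)
  qed
  then show ?thesis
    using S0 by (intro exI[of _ "S / (cmod (coeff g e))\<^sup>2"]) auto
qed

text \<open>The constant terms of \<open>r\<close> are peeled off one at a time:
  \<open>r = c + t * r'\<close> gives \<open>g * r = g * c + (g * t) * r'\<close>, and the induction
  hypothesis applies to \<open>r'\<close> with \<open>g * t\<close> in place of \<open>g\<close>.
  The constant depends on \<open>g\<close> and \<open>M\<close>, but not on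
  \<open>n\<close>.\<close>

lemma deg_norm_sq_split:
  assumes "g \<noteq> 0"
  shows "\<exists>C\<ge>0. \<exists>N. \<forall>n\<ge>N. \<forall>r. \<exists>v a. r = v + monom 1 M * a \<and> (\<forall>i\<ge>M. coeff v i = 0) \<and>
    deg_norm_sq n (g * v) \<le> C * deg_norm_sq n (g * r) \<and>
    deg_norm_sq n (g * (monom 1 M * a)) \<le> C * deg_norm_sq n (g * r)"
  using assms
proof (induction M arbitrary: g)
  case 0
  have "r = 0 + monom 1 0 * r \<and> (\<forall>i\<ge>0. coeff (0 :: complex poly) i = 0) \<and>
      deg_norm_sq n (g * 0) \<le> 1 * deg_norm_sq n (g * r) \<and>
      deg_norm_sq n (g * (monom 1 0 * r)) \<le> 1 * deg_norm_sq n (g * r)" for n r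
    using deg_norm_sq_nonneg[of n "g * r"] by (simp add: deg_norm_sq_def monom_0)
  then show ?case
    using zero_le_one by blast
next
  case (Suc M)
  define g' where "g' = g * [:0, 1:]"
  have "g' \<noteq> 0"
    using Suc.prems by (simp add: g'_def)
  from Suc.IH[OF this] obtain C' N' where C': "C' \<ge> 0"
    and IH: "\<And>n r. n \<ge> N' \<Longrightarrow> \<exists>v a. r = v + monom 1 M * a \<and> (\<forall>i\<ge>M. coeff v i = 0) \<and>
      deg_norm_sq n (g' * v) \<le> C' * deg_norm_sq n (g' * r) \<and>
      deg_norm_sq n (g' * (monom 1 M * a)) \<le> C' * deg_norm_sq n (g' * r)"
    by blast
  obtain C1 N1 where C1: "C1 \<ge> 0"
    and step: "\<And>n r. n \<ge> N1 \<Longrightarrow> deg_norm_sq n (g * [:coeff r 0:]) \<le> C1 * deg_norm_sq n (g * r)"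
    using deg_norm_sq_const_term[OF Suc.prems] by blast
  \<comment> \<open>The factor \<open>2 * (1 + C1)\<close> comes from
    \<open>g' * r' = g * r - g * c\<close>; the constant \<open>C\<close> below comes from
    reassembling \<open>g * c + g' * v\<close>.\<close>
  define B where "B = C' * (2 * (1 + C1))"
  define C where "C = 2 * (C1 + B)"
  have B: "B \<ge> 0" using C' C1 by (simp add: B_def)
  have C: "C \<ge> 0" "B \<le> C" using B C1 by (simp_all add: C_def)
  have "\<exists>v a. r = v + monom 1 (Suc M) * a \<and> (\<forall>i\<ge>Suc M. coeff v i = 0) \<and>
      deg_norm_sq n (g * v) \<le> C * deg_norm_sq n (g * r) \<and>
      deg_norm_sq n (g * (monom 1 (Suc M) * a)) \<le> C * deg_norm_sq n (g * r)"
    if n: "n \<ge> max N' N1" for n r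
  proof -
    obtain c r' where r: "r = pCons c r'" by (cases r)
    define x where "x = deg_norm_sq n (g * r)"
    have x: "x \<ge> 0" by (simp add: x_def deg_norm_sq_nonneg)
    have shift: "g * pCons d q = g * [:d:] + g' * q" for d q
      by (simp add: g'_def algebra_simps)
    have c: "deg_norm_sq n (g * [:c:]) \<le> C1 * x"
      using step[of n r] n by (simp add: r x_def)
    obtain v a where va: "r' = v + monom 1 M * a" "\<forall>i\<ge>M. coeff v i = 0"
      "deg_norm_sq n (g' * v) \<le> C' * deg_norm_sq n (g' * r')"
      "deg_norm_sq n (g' * (monom 1 M * a)) \<le> C' * deg_norm_sq n (g' * r')"
      using IH[of n r'] n by auto
    have "g' * r' = g * r + - (g * [:c:])"
      unfolding r shift[of c r'] by simp
    then have "deg_norm_sq n (g' * r') \<le> 2 * (x + deg_norm_sq n (g * [:c:]))"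
      using deg_norm_sq_add_le[of n "g * r" "- (g * [:c:])"] by (simp add: x_def)
    also have "\<dots> \<le> 2 * (1 + C1) * x"
      using c by (simp add: algebra_simps)
    finally have "C' * deg_norm_sq n (g' * r') \<le> C' * (2 * (1 + C1) * x)"
      by (rule mult_left_mono[OF _ C'])
    then have "C' * deg_norm_sq n (g' * r') \<le> B * x"
      by (simp add: B_def mult.assoc)
    with va(3,4) have v: "deg_norm_sq n (g' * v) \<le> B * x"
      and a: "deg_norm_sq n (g' * (monom 1 M * a)) \<le> B * x"
      by linarith+
    have "deg_norm_sq n (g * pCons c v) \<le> 2 * (deg_norm_sq n (g * [:c:]) + deg_norm_sq n (g' * v))"
      unfolding shift[of c v] by (rule deg_norm_sq_add_le)
    also have "\<dots> \<le> C * x"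
      using c v by (simp add: C_def algebra_simps)
    finally have 1: "deg_norm_sq n (g * pCons c v) \<le> C * x" .
    have "g * (monom 1 (Suc M) * a) = g' * (monom 1 M * a)"
      by (simp add: g'_def monom_Suc)
    then have 2: "deg_norm_sq n (g * (monom 1 (Suc M) * a)) \<le> C * x"
      using a mult_right_mono[OF C(2) x] by (simp only:)
    have "r = pCons c v + monom 1 (Suc M) * a"
      by (simp add: r va(1) monom_Suc)
    moreover have "\<forall>i\<ge>Suc M. coeff (pCons c v) i = 0"
      using va(2) by (auto simp: coeff_pCons split: nat.split)
    ultimately show ?thesis
      using 1 2 unfolding x_def by blast
  qed
  then show ?case
    using C(1) by blast
qed

section \<open>Structure of an ideal containing a nonzero homogeneous element\<close>

text \<open>Euclid's argument: \<open>Y\<close> is chosen with dehomogenization of least degree. A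
  nonzero remainder modulo it would be the dehomogenization of another homogeneous element of
  \<open>I\<close>, of smaller degree in \<open>t\<close>.\<close>

lemma ex_homogeneous_generator:
  assumes I: "is_ideal I" and f: "f \<in> I" "hom_deg n f" "f \<noteq> 0"
  obtains Y s where "Y \<in> I" "hom_deg s Y" "poly Y 1 \<noteq> 0"
    "\<And>m h. h \<in> I \<Longrightarrow> hom_deg m h \<Longrightarrow> poly Y 1 dvd poly h 1"
proof -
  define P where "P k \<longleftrightarrow> (\<exists>Z\<in>I. \<exists>m. hom_deg m Z \<and> Z \<noteq> 0 \<and> degree (poly Z 1) = k)" for k
  define d where "d = (LEAST k. P k)"
  have "P (degree (poly f 1))"
    using f unfolding P_def by blast
  then have "P d"
    unfolding d_def by (rule LeastI)
  then obtain Y s where Y: "Y \<in> I" "hom_deg s Y" "Y \<noteq> 0" "degree (poly Y 1) = d"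
    unfolding P_def by blast
  define g where "g = poly Y 1"
  have g0: "g \<noteq> 0"
    unfolding g_def using dehom_eq_0[OF Y(2)] Y(3) by blast
  have "g dvd poly h 1" if h: "h \<in> I" "hom_deg m h" for m h
  proof (rule ccontr)
    assume nd: "\<not> g dvd poly h 1"
    define p where "p = poly h 1"
    define r where "r = p mod g"
    define q where "q = p div g"
    have r0: "r \<noteq> 0"
      using nd by (simp add: r_def p_def dvd_eq_mod_eq_0)
    \<comment> \<open>\<open>u\<close> is a power of \<open>y\<close>, so it becomes 1 under
      dehomogenization; \<open>v\<close> homogenizes the quotient. Their degrees are chosen so that
      \<open>u * h\<close> and \<open>v * Y\<close> have the same degree.\<close>
    define u where "u = hpoly (s + degree q) (coeff 1)"
    define v where "v = hpoly (m + degree q) (coeff q)"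
    define Z where "Z = u * h - v * Y"
    have "Z \<in> I"
      unfolding Z_def by (intro ideal.subspace_diff[OF I] ideal.subspace_scale[OF I] h(1) Y(1))
    moreover have hZ: "hom_deg (m + s + degree q) Z"
      unfolding Z_def
    proof (rule hom_deg_diff)
      show "hom_deg (m + s + degree q) (u * h)"
        using hom_deg_mult[OF hom_deg_hpoly h(2)] unfolding u_def by (metis add.assoc add.commute)
      show "hom_deg (m + s + degree q) (v * Y)"
        using hom_deg_mult[OF hom_deg_hpoly Y(2)] unfolding v_def by (metis add.assoc add.commute)
    qed
    moreover have dZ: "poly Z 1 = r"
    proof -
      have "poly u 1 = 1"
        unfolding u_def by (rule dehom_hpoly) simp
      moreover have "poly v 1 = q"
        unfolding v_def by (rule dehom_hpoly) simp
      moreover have "p = q * g + r"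
        unfolding q_def r_def by simp
      ultimately show ?thesis
        by (simp add: Z_def g_def[symmetric] p_def[symmetric])
    qed
    moreover have "Z \<noteq> 0"
      using dZ r0 by auto
    ultimately have "P (degree r)"
      unfolding P_def by blast
    then have "d \<le> degree r"
      unfolding d_def by (rule Least_le)
    moreover have "degree r < degree g"
      using degree_mod_less[OF g0, of p] r0 unfolding r_def by blast
    ultimately show False
      using Y(4) by (simp add: g_def)
  qed
  then show thesis
    using that[OF Y(1,2)] g0 unfolding g_def by blast
qed

text \<open>
  If \<open>t ^ R - w\<close> times \<open>g\<close> comes from the ideal, then so does \<open>t ^ (R * K) - w ^ K\<close> times \<open>g\<close>.
  Since \<open>degree w < R\<close>, for large \<open>K\<close> the homogenization of \<open>g * w ^ K\<close> is divisible by so high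
  a power of \<open>y\<close> that it lies in the ideal as well.
\<close>

lemma ex_x_power_multiple:
  assumes I: "is_ideal I"
    and Y: "Y \<in> I" "hom_deg s Y" "poly Y 1 = g"
    and f: "f \<in> I" "hom_deg (D + R) f" "poly f 1 = g * (monom 1 R - w)"
    and w: "w = 0 \<or> degree w < R"
  shows "\<exists>M. \<exists>X\<in>I. hom_deg (D + M) X \<and> poly X 1 = g * monom 1 M"
proof -
  have wR: "degree w \<le> R"
    using w by auto
  have powers: "\<exists>Z\<in>I. hom_deg (D + R * K) Z \<and> poly Z 1 = g * (monom 1 (R * K) - w ^ K)" for K
  proof (induction K)
    case 0
    show ?case
      using ideal.subspace_0[OF I] by (intro bexI[of _ 0]) (auto simp: hom_deg_def)
  next
    case (Suc K)
    then obtain Z where Z: "Z \<in> I" "hom_deg (D + R * K) Z" "poly Z 1 = g * (monom 1 (R * K) - w ^ K)"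
      by blast
    \<comment> \<open>These homogenize the multipliers in \<open>w * (t^(R*K) - w^K) + t^(R*K) *
      (t^R - w) = t^(R*(K+1)) - w^(K+1)\<close>.\<close>
    define u where "u = hpoly R (coeff w)"
    define v where "v = hpoly (R * K) (coeff (monom 1 (R * K)))"
    have "u * Z + v * f \<in> I"
      by (intro ideal.subspace_add[OF I] ideal.subspace_scale[OF I] Z(1) f(1))
    moreover have "hom_deg (D + R * Suc K) (u * Z + v * f)"
    proof (rule hom_deg_add)
      have "hom_deg (R + (D + R * K)) (u * Z)"
        unfolding u_def by (rule hom_deg_mult[OF hom_deg_hpoly Z(2)])
      then show "hom_deg (D + R * Suc K) (u * Z)"
        by (simp add: add_ac)
      have "hom_deg (R * K + (D + R)) (v * f)"
        unfolding v_def by (rule hom_deg_mult[OF hom_deg_hpoly f(2)])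
      then show "hom_deg (D + R * Suc K) (v * f)"
        by (simp add: add_ac)
    qed
    moreover have "poly (u * Z + v * f) 1 = g * (monom 1 (R * Suc K) - w ^ Suc K)"
    proof -
      have "poly u 1 = w"
        unfolding u_def by (rule dehom_hpoly[OF wR])
      moreover have "poly v 1 = monom 1 (R * K)"
        unfolding v_def by (rule dehom_hpoly[OF degree_monom_le])
      ultimately have "poly (u * Z + v * f) 1 =
          w * (g * (monom 1 (R * K) - w ^ K)) + monom 1 (R * K) * (g * (monom 1 R - w))"
        by (simp add: Z(3) f(3))
      also have "\<dots> = g * (monom 1 R * monom 1 (R * K) - w * w ^ K)"
        by algebra
      also have "monom 1 R * monom 1 (R * K) = (monom 1 (R * Suc K) :: complex poly)"
        by (simp add: mult_monom)
      finally show ?thesis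
        by simp
    qed
    ultimately show ?case by blast
  qed
  show ?thesis
  proof (cases "w = 0")
    case True
    from powers[of 1] show ?thesis
      using True by auto
  next
    case False
    then have R: "degree w < R"
      using w by blast
    \<comment> \<open>The exponent \<open>K = s\<close> is large enough:
      \<open>degree w + 1 \<le> R\<close> gives \<open>degree (w^s) + s \<le> R * s\<close>, so
      \<open>w^s\<close> can be homogenized in the degree \<open>D + R * s - s\<close> that a
      multiplier of \<open>Y\<close> must have.\<close>
    obtain Z where Z: "Z \<in> I" "hom_deg (D + R * s) Z" "poly Z 1 = g * (monom 1 (R * s) - w ^ s)"
      using powers by blast
    have "s * Suc (degree w) \<le> s * R"
      using R by (intro mult_le_mono2) simp
    then have deg: "s + degree w * s \<le> R * s"
      by (simp add: mult.commute)
    then have sR: "s \<le> D + R * s" and "degree w * s \<le> D + R * s - s"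
      by linarith+
    then have dw: "degree (w ^ s) \<le> D + R * s - s"
      using degree_power_le[of w s] by linarith
    define u where "u = hpoly (D + R * s - s) (coeff (w ^ s))"
    have "u * Y + Z \<in> I"
      by (intro ideal.subspace_add[OF I] ideal.subspace_scale[OF I] Z(1) Y(1))
    moreover have "hom_deg (D + R * s) (u * Y + Z)"
      using hom_deg_mult[OF hom_deg_hpoly Y(2), of "D + R * s - s" "coeff (w ^ s)"] sR Z(2)
      by (auto simp: u_def intro: hom_deg_add)
    moreover have "poly (u * Y + Z) 1 = g * monom 1 (R * s)"
      using dehom_hpoly[OF dw] by (simp add: u_def Y(3) Z(3) algebra_simps)
    ultimately show ?thesis by blast
  qed
qed

text \<open>Here \<open>y^\<delta>\<close> is the largest power of \<open>y\<close> dividing all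
  homogeneous elements of \<open>I\<close>. If \<open>G\<close> is the homogenization of
  \<open>g\<close> in degree \<open>degree g\<close>, then \<open>X\<close> is
  \<open>x^M * y^\<delta> * G\<close>, with no surplus power of \<open>y\<close>, while
  \<open>Y\<close> is \<open>G\<close> times some power of \<open>y\<close>.\<close>

lemma homogeneous_ideal_structure:
  assumes I: "is_ideal I" and f: "f \<in> I" "hom_deg n f" "f \<noteq> 0"
  obtains g Y X s M \<delta> where "g \<noteq> 0"
    "Y \<in> I" "hom_deg s Y" "poly Y 1 = g"
    "X \<in> I" "hom_deg (degree g + \<delta> + M) X" "poly X 1 = g * monom 1 M"
    "\<And>m h. h \<in> I \<Longrightarrow> hom_deg m h \<Longrightarrow> h \<noteq> 0 \<Longrightarrow> g dvd poly h 1 \<and> degree (poly h 1) + \<delta> \<le> m"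
proof -
  obtain Y s where Y: "Y \<in> I" "hom_deg s Y" "poly Y 1 \<noteq> 0"
    and dvd: "\<And>m h. h \<in> I \<Longrightarrow> hom_deg m h \<Longrightarrow> poly Y 1 dvd poly h 1"
    using ex_homogeneous_generator[OF assms] by blast
  define g where "g = poly Y 1"
  \<comment> \<open>For nonzero \<open>Z\<close> of degree \<open>m\<close>, the difference
    \<open>m - degree (poly Z 1)\<close> is the exponent of the exact power of \<open>y\<close>
    dividing \<open>Z\<close>.\<close>
  define P where "P k \<longleftrightarrow> (\<exists>Z\<in>I. \<exists>m. hom_deg m Z \<and> Z \<noteq> 0 \<and> m - degree (poly Z 1) = k)" for k
  define \<delta> where "\<delta> = (LEAST k. P k)"
  have "P (n - degree (poly f 1))"
    using f unfolding P_def by blast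
  then have "P \<delta>"
    unfolding \<delta>_def by (rule LeastI)
  then obtain e m where e: "e \<in> I" "hom_deg m e" "e \<noteq> 0" "m - degree (poly e 1) = \<delta>"
    unfolding P_def by blast
  have bound: "degree (poly h 1) + \<delta> \<le> k" if "h \<in> I" "hom_deg k h" "h \<noteq> 0" for k h
  proof -
    have "P (k - degree (poly h 1))"
      using that unfolding P_def by blast
    then have "\<delta> \<le> k - degree (poly h 1)"
      unfolding \<delta>_def by (rule Least_le)
    then show ?thesis
      using degree_dehom[OF that(2)] by linarith
  qed
  obtain r where r: "poly e 1 = g * r"
    using dvd[OF e(1,2)] unfolding g_def by (elim dvdE)
  have "poly e 1 \<noteq> 0"
    using dehom_eq_0[OF e(2)] e(3) by blast
  then have r0: "r \<noteq> 0" and g0: "g \<noteq> 0"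
    using r by auto
  define c where "c = lead_coeff r"
  define R where "R = degree r"
  have c: "c \<noteq> 0"
    using r0 by (simp add: c_def)
  \<comment> \<open>Scaling \<open>e\<close> makes its cofactor \<open>r\<close> monic, that is,
    \<open>t^R - w\<close> with only lower terms in \<open>w\<close>, the form that
    \<open>ex_x_power_multiple\<close> expects.\<close>
  define w where "w = monom 1 R - smult (inverse c) r"
  define e' where "e' = [:[:inverse c:]:] * e"
  have "degree (poly e 1) = degree g + R"
    unfolding r R_def by (rule degree_mult_eq[OF g0 r0])
  then have m: "m = degree g + \<delta> + R"
    using e(4) degree_dehom[OF e(2)] by linarith
  have "e' \<in> I"
    unfolding e'_def by (rule ideal.subspace_scale[OF I e(1)])
  moreover have "hom_deg (degree g + \<delta> + R) e'"
    using e(2) c unfolding hom_deg_def e'_def coeff2_smult m by simp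
  moreover have "poly e' 1 = g * (monom 1 R - w)"
    by (simp add: e'_def w_def r)
  moreover have "w = 0 \<or> degree w < R"
  proof (cases "w = 0")
    case False
    have "degree w \<le> R"
      unfolding w_def R_def by (intro degree_diff_le degree_monom_le degree_smult_le)
    moreover have "coeff w R = 0"
      using c by (simp add: w_def c_def R_def)
    then have "degree w \<noteq> R"
      using False by (metis leading_coeff_0_iff)
    ultimately show ?thesis by linarith
  qed simp
  ultimately obtain M X where "X \<in> I" "hom_deg (degree g + \<delta> + M) X" "poly X 1 = g * monom 1 M"
    using ex_x_power_multiple[OF I Y(1,2) g_def[symmetric]] by blast
  then show thesis
    using that[of g Y s X \<delta> M] g0 Y dvd bound unfolding g_def by blast
qed

section \<open>Division in high degrees\<close>

text \<open>The splitting \<open>r = v + t^M * a\<close> lifts to multipliers of \<open>Y\<close>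
  and \<open>X\<close> in degree \<open>n\<close>. The one for \<open>a\<close> fits because
  \<open>X\<close> contains no power of \<open>y\<close> beyond the \<open>y^\<delta>\<close> shared
  by all homogeneous elements of \<open>I\<close>.\<close>

lemma high_degree_division:
  assumes I: "is_ideal I" and f: "f \<in> I" "hom_deg n f" "f \<noteq> 0"
  shows "\<exists>X\<in>I. \<exists>Y\<in>I. \<exists>C\<ge>0. \<exists>N. \<forall>n\<ge>N. \<forall>h\<in>I. hom_deg n h \<longrightarrow>
    (\<exists>a b. h = a * X + b * Y \<and> hom_deg n (a * X) \<and> hom_deg n (b * Y) \<and>
      (H2_norm (a * X))\<^sup>2 \<le> C * (H2_norm h)\<^sup>2 \<and> (H2_norm (b * Y))\<^sup>2 \<le> C * (H2_norm h)\<^sup>2)"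
proof -
  obtain g Y X s M \<delta> where g0: "g \<noteq> 0"
    and Y: "Y \<in> I" "hom_deg s Y" "poly Y 1 = g"
    and X: "X \<in> I" "hom_deg (degree g + \<delta> + M) X" "poly X 1 = g * monom 1 M"
    and str: "\<And>m h. h \<in> I \<Longrightarrow> hom_deg m h \<Longrightarrow> h \<noteq> 0 \<Longrightarrow> g dvd poly h 1 \<and> degree (poly h 1) + \<delta> \<le> m"
    by (rule homogeneous_ideal_structure[OF assms], rule that, assumption+)
  obtain C N where C: "C \<ge> 0" and split: "\<And>n r. n \<ge> N \<Longrightarrow>
      \<exists>v a. r = v + monom 1 M * a \<and> (\<forall>i\<ge>M. coeff v i = 0) \<and>
        deg_norm_sq n (g * v) \<le> C * deg_norm_sq n (g * r) \<and>
        deg_norm_sq n (g * (monom 1 M * a)) \<le> C * deg_norm_sq n (g * r)"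
    using deg_norm_sq_split[OF g0, of M] by blast
  define D where "D = degree g + \<delta> + M"
  \<comment> \<open>In the threshold, \<open>N\<close> serves the splitting, \<open>s + M\<close>
    leaves room for \<open>v\<close> in degree \<open>n - s\<close>, and \<open>D\<close> makes the
    degree \<open>n - D\<close> of the other multiplier a true difference.\<close>
  have "\<exists>a b. h = a * X + b * Y \<and> hom_deg n (a * X) \<and> hom_deg n (b * Y) \<and>
      (H2_norm (a * X))\<^sup>2 \<le> C * (H2_norm h)\<^sup>2 \<and> (H2_norm (b * Y))\<^sup>2 \<le> C * (H2_norm h)\<^sup>2"
    if n: "n \<ge> N + s + M + D" and h: "h \<in> I" "hom_deg n h" for n h
  proof (cases "h = 0")
    case True
    then show ?thesis
      by (intro exI[of _ 0]) (simp add: hom_deg_def)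
  next
    case False
    obtain r where r: "poly h 1 = g * r"
      using str[OF h False] by blast
    have "poly h 1 \<noteq> 0"
      using dehom_eq_0[OF h(2)] False by blast
    then have r0: "r \<noteq> 0" using r by auto
    have dr: "degree r + degree g + \<delta> \<le> n"
      using str[OF h False] degree_mult_eq[OF g0 r0] unfolding r by linarith
    obtain v a where va: "r = v + monom 1 M * a" "\<forall>i\<ge>M. coeff v i = 0"
      "deg_norm_sq n (g * v) \<le> C * deg_norm_sq n (g * r)"
      "deg_norm_sq n (g * (monom 1 M * a)) \<le> C * deg_norm_sq n (g * r)"
      using split[of n r] n by auto
    have dv: "degree v \<le> n - s"
      using va(2) n by (intro degree_le) auto
    \<comment> \<open>Above \<open>t^M\<close> the coefficients of \<open>r\<close> are those of
      \<open>a\<close> shifted by \<open>M\<close>, and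
      \<open>degree r \<le> n - degree g - \<delta>\<close>, which is
      \<open>n - D + M\<close>.\<close>
    have da: "degree a \<le> n - D"
    proof (intro degree_le allI impI)
      fix i assume i: "n - D < i"
      have "coeff a i = coeff r (i + M) - coeff v (i + M)"
        unfolding va(1) by (simp add: coeff_monom_mult)
      moreover have "degree r < i + M"
        using i dr n by (simp add: D_def)
      ultimately show "coeff a i = 0"
        using va(2) by (simp add: coeff_eq_0)
    qed
    define \<alpha> where "\<alpha> = hpoly (n - D) (coeff a)"
    define \<beta> where "\<beta> = hpoly (n - s) (coeff v)"
    have hX: "hom_deg n (\<alpha> * X)"
      using hom_deg_mult[OF hom_deg_hpoly X(2), of "n - D" "coeff a"] n by (simp add: \<alpha>_def D_def)
    have hY: "hom_deg n (\<beta> * Y)"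
      using hom_deg_mult[OF hom_deg_hpoly Y(2), of "n - s" "coeff v"] n by (simp add: \<beta>_def)
    have pX: "poly (\<alpha> * X) 1 = g * (monom 1 M * a)"
      using dehom_hpoly[OF da] by (simp add: \<alpha>_def X(3) mult_ac)
    have pY: "poly (\<beta> * Y) 1 = g * v"
      using dehom_hpoly[OF dv] by (simp add: \<beta>_def Y(3) mult_ac)
    have "h = \<alpha> * X + \<beta> * Y"
    proof (rule dehom_inject[OF h(2) hom_deg_add[OF hX hY]])
      show "poly h 1 = poly (\<alpha> * X + \<beta> * Y) 1"
        unfolding poly_add pX pY r va(1) by (simp add: distrib_left)
    qed
    moreover have "(H2_norm (\<alpha> * X))\<^sup>2 \<le> C * (H2_norm h)\<^sup>2" "(H2_norm (\<beta> * Y))\<^sup>2 \<le> C * (H2_norm h)\<^sup>2"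
      unfolding H2_norm_sq_dehom[OF h(2)] H2_norm_sq_dehom[OF hX] H2_norm_sq_dehom[OF hY] pX pY r
      by (fact va(3,4))+
    ultimately show ?thesis
      using hX hY by blast
  qed
  then show ?thesis
    using X(1) Y(1) C by blast
qed

section \<open>Assembling low and high degrees\<close>

theorem theorem2p5:
  fixes I :: "complex poly poly set"
  assumes "is_ideal I" and "homogeneous_ideal I"
  shows "stable_division H2_norm I"
proof -
  note I = assms(1)
  have comp: "component n h \<in> I" if "h \<in> I" for n h
    by (rule component_in_ideal[OF assms(2) that])
  obtain X Y C N where X: "X \<in> I" and Y: "Y \<in> I" and C: "C \<ge> 0"
    and high: "\<And>n h. n \<ge> N \<Longrightarrow> h \<in> I \<Longrightarrow> hom_deg n h \<Longrightarrow>
      \<exists>a b. h = a * X + b * Y \<and> hom_deg n (a * X) \<and> hom_deg n (b * Y) \<and>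
      (H2_norm (a * X))\<^sup>2 \<le> C * (H2_norm h)\<^sup>2 \<and> (H2_norm (b * Y))\<^sup>2 \<le> C * (H2_norm h)\<^sup>2"
  proof (cases "\<exists>f\<in>I. \<exists>n. hom_deg n f \<and> f \<noteq> 0")
    case True
    then obtain f n where "f \<in> I" "hom_deg n f" "f \<noteq> 0" by blast
    from high_degree_division[OF I this] show thesis
      using that by blast
  next
    \<comment> \<open>All homogeneous elements of \<open>I\<close> vanish here, so zero serves as
      both generators.\<close>
    case False
    then have "h = 0" if "h \<in> I" "hom_deg n h" for n h
      using that by blast
    then show thesis
      using ideal.subspace_0[OF I] by (intro that[of 0 0 0 0]) (auto simp: hom_deg_def)
  qed
  \<comment> \<open>The elements of \<open>I\<close> of degree below \<open>N\<close>: a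
    finite-dimensional linear space, to which elimination applies.\<close>
  define W where "W = {h \<in> I. \<forall>a b. coeff2 h a b \<noteq> 0 \<longrightarrow> a + b < N}"
  have "\<exists>F L. finite F \<and> F \<subseteq> W \<and> 0 \<le> L \<and> (\<forall>h\<in>W. divisible_within F (L * (H2_norm h)\<^sup>2) h)"
  proof (rule finite_support_division)
    show "finite ({..N} \<times> {..N})" by simp
    show "0 \<in> W"
      using ideal.subspace_0[OF I] by (simp add: W_def)
    show "p + [:[:c:]:] * q \<in> W" if "p \<in> W" "q \<in> W" for c p q
    proof -
      have "a + b < N" if "coeff2 (p + [:[:c:]:] * q) a b \<noteq> 0" for a b
      proof -
        have "coeff2 p a b \<noteq> 0 \<or> coeff2 q a b \<noteq> 0"
          using that unfolding coeff2_add coeff2_smult by auto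
        then show ?thesis
          using \<open>p \<in> W\<close> \<open>q \<in> W\<close> unfolding W_def by blast
      qed
      moreover have "p + [:[:c:]:] * q \<in> I"
        using that ideal.subspace_add[OF I] ideal.subspace_scale[OF I] unfolding W_def by blast
      ultimately show ?thesis
        unfolding W_def by blast
    qed
    show "(a, b) \<in> {..N} \<times> {..N}" if "p \<in> W" "coeff2 p a b \<noteq> 0" for p a b
    proof -
      have "a + b < N" using that unfolding W_def by blast
      then show ?thesis by simp
    qed
  qed
  then obtain F L where F: "finite F" "F \<subseteq> W" "0 \<le> L"
    "\<And>h. h \<in> W \<Longrightarrow> divisible_within F (L * (H2_norm h)\<^sup>2) h"
    by blast
  define G where "G = F \<union> ({X} \<union> {Y})"
  define K where "K = 2 * (L + 4 * C)"
  have div: "divisible_within G (K * (H2_norm h)\<^sup>2) h" if h: "h \<in> I" for h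
  proof -
    obtain l0 where l0: "\<forall>l\<ge>l0. h = (\<Sum>n\<le>l. component n h)"
      using ex_sum_component by blast
    \<comment> \<open>The cutoff is at least \<open>N\<close> so that the range up to
      \<open>l\<close> contains all the low degrees.\<close>
    define l where "l = max l0 N"
    have h_sum: "h = (\<Sum>n\<le>l. component n h)"
      using l0 l_def by simp
    define H where "H = {n. N \<le> n \<and> n \<le> l}"
    have fin: "finite H" "finite {..<N}"
      unfolding H_def by auto
    have parts: "{..l} = {..<N} \<union> H" "{..<N} \<inter> H = {}"
      unfolding H_def l_def by auto
    define h1 where "h1 = (\<Sum>n<N. component n h)"
    define h2 where "h2 = (\<Sum>n\<in>H. component n h)"
    have h12: "h = h1 + h2"
      unfolding h1_def h2_def by (subst h_sum) (simp only: parts sum.union_disjoint[OF fin(2,1) parts(2)])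
    have norm_h1: "(H2_norm h1)\<^sup>2 = (\<Sum>n<N. (H2_norm (component n h))\<^sup>2)"
      unfolding h1_def by (rule H2_norm_sq_sum_hom) auto
    have norm_h2: "(H2_norm h2)\<^sup>2 = (\<Sum>n\<in>H. (H2_norm (component n h))\<^sup>2)"
      unfolding h2_def by (rule H2_norm_sq_sum_hom) (use fin in auto)
    have "(H2_norm h)\<^sup>2 = (\<Sum>n\<le>l. (H2_norm (component n h))\<^sup>2)"
      by (subst h_sum, rule H2_norm_sq_sum_hom) auto
    also have "\<dots> = (H2_norm h1)\<^sup>2 + (H2_norm h2)\<^sup>2"
      unfolding norm_h1 norm_h2 parts(1) by (rule sum.union_disjoint[OF fin(2,1) parts(2)])
    finally have le: "(H2_norm h1)\<^sup>2 \<le> (H2_norm h)\<^sup>2" "(H2_norm h2)\<^sup>2 \<le> (H2_norm h)\<^sup>2"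
      by simp_all
    have "h1 \<in> W"
    proof -
      have "h1 \<in> I"
        unfolding h1_def by (intro ideal.subspace_sum[OF I] comp[OF h])
      moreover have "a + b < N" if nz: "coeff2 h1 a b \<noteq> 0" for a b
      proof -
        obtain n where "n < N" "coeff2 (component n h) a b \<noteq> 0"
          using nz sum.neutral[of "{..<N}" "\<lambda>n. coeff2 (component n h) a b"]
          unfolding h1_def coeff2_sum lessThan_iff by blast
        then show ?thesis
          by (simp add: coeff2_component split: if_splits)
      qed
      ultimately show ?thesis
        unfolding W_def by blast
    qed
    then have 1: "divisible_within F (L * (H2_norm h)\<^sup>2) h1"
      using divisible_within_mono[OF F(4)] mult_left_mono[OF le(1) F(3)] by blast
    have "\<forall>n\<in>H. \<exists>a b. component n h = a * X + b * Y \<and> hom_deg n (a * X) \<and> hom_deg n (b * Y) \<and>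
      (H2_norm (a * X))\<^sup>2 \<le> C * (H2_norm (component n h))\<^sup>2 \<and>
      (H2_norm (b * Y))\<^sup>2 \<le> C * (H2_norm (component n h))\<^sup>2"
      unfolding H_def using high comp[OF h] hom_deg_component by blast
    then obtain a b where ab: "\<And>n. n \<in> H \<Longrightarrow> component n h = a n * X + b n * Y"
      "\<And>n. n \<in> H \<Longrightarrow> hom_deg n (a n * X)" "\<And>n. n \<in> H \<Longrightarrow> hom_deg n (b n * Y)"
      "\<And>n. n \<in> H \<Longrightarrow> (H2_norm (a n * X))\<^sup>2 \<le> C * (H2_norm (component n h))\<^sup>2"
      "\<And>n. n \<in> H \<Longrightarrow> (H2_norm (b n * Y))\<^sup>2 \<le> C * (H2_norm (component n h))\<^sup>2"
      by metis
    \<comment> \<open>The multipliers of all high degrees are summed into one multiplier per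
      generator. Orthogonality of degrees lets the squared norms add up, so \<open>C\<close> does
      not grow with the number of degrees.\<close>
    have bound: "(H2_norm ((\<Sum>n\<in>H. c n) * Z))\<^sup>2 \<le> C * (H2_norm h)\<^sup>2"
      if "\<And>n. n \<in> H \<Longrightarrow> hom_deg n (c n * Z)"
        "\<And>n. n \<in> H \<Longrightarrow> (H2_norm (c n * Z))\<^sup>2 \<le> C * (H2_norm (component n h))\<^sup>2" for c Z
    proof -
      have "(H2_norm ((\<Sum>n\<in>H. c n) * Z))\<^sup>2 = (\<Sum>n\<in>H. (H2_norm (c n * Z))\<^sup>2)"
        unfolding sum_distrib_right by (rule H2_norm_sq_sum_hom[OF fin(1) that(1)])
      also have "\<dots> \<le> (\<Sum>n\<in>H. C * (H2_norm (component n h))\<^sup>2)"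
        by (rule sum_mono[OF that(2)])
      also have "\<dots> = C * (H2_norm h2)\<^sup>2"
        unfolding norm_h2 by (rule sum_distrib_left[symmetric])
      also have "\<dots> \<le> C * (H2_norm h)\<^sup>2"
        by (rule mult_left_mono[OF le(2) C])
      finally show ?thesis .
    qed
    have h2: "h2 = (\<Sum>n\<in>H. a n) * X + (\<Sum>n\<in>H. b n) * Y"
      unfolding h2_def sum_distrib_right sum.distrib[symmetric] by (rule sum.cong[OF refl ab(1)])
    have 2: "divisible_within ({X} \<union> {Y}) (2 * (C * (H2_norm h)\<^sup>2 + C * (H2_norm h)\<^sup>2)) h2"
      unfolding h2 using bound[of a X] bound[of b Y] ab(2-5)
      by (intro divisible_within_Un divisible_within_singleton) auto
    have "divisible_within G (2 * (L * (H2_norm h)\<^sup>2 + 2 * (C * (H2_norm h)\<^sup>2 + C * (H2_norm h)\<^sup>2))) h"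
      unfolding G_def by (subst h12, rule divisible_within_Un[OF F(1) _ 1 2]) simp
    then show ?thesis
      by (rule divisible_within_mono) (simp add: K_def algebra_simps)
  qed
  have GI: "G \<subseteq> I" "finite G"
    using F(1,2) X Y by (auto simp: G_def W_def)
  have "ideal_generated G = I"
  proof
    show "ideal_generated G \<subseteq> I"
      using GI(1) I by (rule ideal.span_minimal)
    show "I \<subseteq> ideal_generated G"
    proof
      fix h assume "h \<in> I"
      then obtain a where "h = (\<Sum>f\<in>G. a f * f)"
        using div unfolding divisible_within_def by blast
      then show "h \<in> ideal_generated G"
        by (auto intro: ideal.span_sum ideal.span_scale ideal.span_base)
    qed
  qed
  then show ?thesis
    using div GI unfolding stable_division_def divisible_within_def by blast
qed

end
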